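(* Let $n\ge 1$ and let $A_n=(a_{ij})_{1\le i,j\le n}$ be the $n$-th order permutation generation matrix. Then for all $1\le i,j\le n$: (i) if $i+j<n+1$, then $a_{ij}=0$; (ii) if $i+j=n+1$, then $a_{ij}=1$; (iii) if $i+j>n+1$ and $i<n$, then $a_{ij}=(j-1)\,a_{i,\,j-1}+a_{i+1,\,j-1}$; (iv) if $i=n$ and $j\ge 2$, then $a_{nj}=(j-1)\,a_{n,\,j-1}$.
   Context: For an integer $k\ge 1$ and a natural number $m$, $P_k(m) = m(m+1)\cdots(m+k-1)$. The $n$-th order permutation generation matrix $A_n$ is the $n\times n$ matrix with constant (independent of $m$) real entries such that, for all natural numbers $m$, $$(P_1(m), P_2(m), \ldots, P_n(m)) = (m^n, m^{n-1}, \ldots, m)\,A_n ,$$ i.e. $P_j(m)=\sum_{i=1}^n a_{ij}\,m^{n+1-i}$ for $1\le j\le n$. (Such a matrix exists and is unique.) *)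

theory Defs
  imports Complex_Main "Jordan_Normal_Form.Matrix" "HOL-Combinatorics.Stirling"
    "HOL-Computational_Algebra.Polynomial"
begin

text \<open>
  The product \<open>P\<^sub>k(m) = m (m + 1) \<dots> (m + k - 1)\<close> is the rising factorial
  \<^term>\<open>pochhammer (real m) k\<close>.  Vectors are indexed from 0, so the rows below are
  \<open>(P\<^sub>1(m), \<dots>, P\<^sub>n(m))\<close> and \<open>(m\<^sup>n, \<dots>, m)\<close>.
\<close>

definition is_perm_gen_mat :: "nat \<Rightarrow> real mat \<Rightarrow> bool" where
  "is_perm_gen_mat n A \<longleftrightarrow>
     A \<in> carrier_mat n n \<and>
     (\<forall>m::nat. mat_of_row (vec n (\<lambda>j. pochhammer (real m) (j + 1)))
             = mat_of_row (vec n (\<lambda>i. real m ^ (n - i))) * A)"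

definition perm_gen_mat :: "nat \<Rightarrow> real mat" where
  "perm_gen_mat n = (THE A. is_perm_gen_mat n A)"

text \<open>The entry $a_{ij}$ of $A_n$, with \<open>i\<close> and \<open>j\<close> counted from 1 up to \<open>n\<close>.\<close>

definition perm_gen_entry :: "nat \<Rightarrow> nat \<Rightarrow> nat \<Rightarrow> real" where
  "perm_gen_entry n i j = perm_gen_mat n $$ (i - 1, j - 1)"

lemma is_perm_gen_mat_iff:
  "is_perm_gen_mat n A \<longleftrightarrow>
     A \<in> carrier_mat n n \<and>
     (\<forall>m::nat. \<forall>j<n. pochhammer (real m) (j + 1) = (\<Sum>i<n. real m ^ (n - i) * A $$ (i, j)))"
proof (cases "A \<in> carrier_mat n n")
  case True
  have "mat_of_row (vec n (\<lambda>j. pochhammer (real m) (j + 1)))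
             = mat_of_row (vec n (\<lambda>i. real m ^ (n - i))) * A \<longleftrightarrow>
     (\<forall>j<n. pochhammer (real m) (j + 1) = (\<Sum>i<n. real m ^ (n - i) * A $$ (i, j)))" for m
    using True
    by (auto simp: mat_eq_iff scalar_prod_def mat_of_row_def lessThan_atLeast0 intro!: sum.cong)
  then show ?thesis by (simp add: is_perm_gen_mat_def)
qed (simp add: is_perm_gen_mat_def)

text \<open>The definite description above is well defined.\<close>

lemma ex1_perm_gen_mat: "\<exists>!A. is_perm_gen_mat n A"
proof (rule ex_ex1I)
  define B where "B = mat n n (\<lambda>(i, j). real (stirling (j + 1) (n - i)))"
  have "pochhammer (real m) (j + 1) = (\<Sum>i<n. real m ^ (n - i) * B $$ (i, j))" if "j < n" for m j
  proof -
    have "pochhammer (real m) (j + 1) = (\<Sum>k\<le>j + 1. real (stirling (j + 1) k) * real m ^ k)"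
      by (simp only: stirling_pochhammer)
    also have "\<dots> = (\<Sum>k\<in>{1..n}. real (stirling (j + 1) k) * real m ^ k)"
    proof (rule sum.mono_neutral_cong)
      fix k assume "k \<in> {..j + 1} - {1..n}"
      then have "k = 0" using that by auto
      then show "real (stirling (j + 1) k) * real m ^ k = 0" by simp
    qed (use that in auto)
    also have "\<dots> = (\<Sum>i<n. real (stirling (j + 1) (n - i)) * real m ^ (n - i))"
      by (rule sum.reindex_bij_witness[of _ "\<lambda>i. n - i" "\<lambda>k. n - k"]) auto
    finally show ?thesis using that by (simp add: B_def mult.commute)
  qed
  then have "is_perm_gen_mat n B"
    by (auto simp: is_perm_gen_mat_iff B_def)
  then show "\<exists>A. is_perm_gen_mat n A" ..
next
  fix A B assume A: "is_perm_gen_mat n A" and B: "is_perm_gen_mat n B"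
  have "A $$ (i, j) = B $$ (i, j)" if ij: "i < n" "j < n" for i j
  proof -
    define p where "p = (\<Sum>k<n. monom (A $$ (k, j) - B $$ (k, j)) (n - k))"
    have "poly p (real m) = 0" for m
    proof -
      have "(\<Sum>k<n. real m ^ (n - k) * A $$ (k, j)) = (\<Sum>k<n. real m ^ (n - k) * B $$ (k, j))"
        using A B ij unfolding is_perm_gen_mat_iff by metis
      then show ?thesis
        by (simp add: p_def poly_sum poly_monom algebra_simps sum_subtractf)
    qed
    then have "range real \<subseteq> {x. poly p x = 0}" by auto
    moreover have "infinite (range real)"
      by (simp add: range_inj_infinite)
    ultimately have "p = 0"
      using poly_roots_finite finite_subset by blast
    then have "0 = coeff p (n - i)" by simp
    also have "\<dots> = (\<Sum>k<n. if k = i then A $$ (k, j) - B $$ (k, j) else 0)"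
      unfolding p_def coeff_sum by (rule sum.cong) (use ij in auto)
    also have "\<dots> = A $$ (i, j) - B $$ (i, j)" using ij by simp
    finally show ?thesis by simp
  qed
  then show "A = B"
    using A B by (auto simp: is_perm_gen_mat_def intro!: eq_matI)
qed

end

theory Submission
  imports Defs
begin

text \<open>
  Column \<open>j\<close> of the matrix lists the coefficients of the rising factorial
  \<open>x (x + 1) \<dots> (x + j - 1)\<close> in descending powers of \<open>x\<close>.  These coefficients are the unsigned
  Stirling numbers of the first kind, so that \<open>a\<^sub>i\<^sub>j = stirling j (n + 1 - i)\<close>
  (lemma \<open>perm_gen_entry_eq_stirling\<close>).  All four claims are then facts about Stirling numbers:
  \<open>stirling j k\<close> vanishes for \<open>k > j\<close>, as the rising factorial has degree \<open>j\<close>; it is 1 for \<open>k = j\<close>,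
  as the rising factorial is monic; and the two recurrences are the rule
  \<open>stirling (Suc a) (Suc b) = a * stirling a (Suc b) + stirling a b\<close>, which compares coefficients in
  \<open>P\<^sub>a\<^sub>+\<^sub>1(x) = (x + a) P\<^sub>a(x)\<close>.  In the last row \<open>b = 0\<close>, and the second summand vanishes because the
  rising factorial has no constant term.
\<close>

text \<open>
  Stirling's expansion with the summation range stretched to all of \<open>1, \<dots>, n\<close>: the constant term
  is zero because the product contains the factor \<open>x\<close>, and the powers above its degree have
  Stirling number zero.
\<close>

lemma pochhammer_eq_sum_stirling_descending:
  fixes x :: real
  assumes "0 < k" "k \<le> n"
  shows "pochhammer x k = (\<Sum>i<n. x ^ (n - i) * real (stirling k (n - i)))"
proof -
  have "pochhammer x k = (\<Sum>l\<le>k. real (stirling k l) * x ^ l)"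
    by (simp only: stirling_pochhammer)
  also have "\<dots> = (\<Sum>l\<in>{1..n}. real (stirling k l) * x ^ l)"
  proof (rule sum.mono_neutral_cong)
    fix l assume "l \<in> {..k} - {1..n}"
    then have "l = 0" using assms by auto
    then show "real (stirling k l) * x ^ l = 0"
      using assms by (cases k) auto
  qed (use assms in auto)
  also have "\<dots> = (\<Sum>i<n. x ^ (n - i) * real (stirling k (n - i)))"
    by (rule sum.reindex_bij_witness[of _ "\<lambda>i. n - i" "\<lambda>l. n - l"]) auto
  finally show ?thesis .
qed

lemma perm_gen_mat_eq_stirling:
  "perm_gen_mat n = mat n n (\<lambda>(i, j). real (stirling (j + 1) (n - i)))"
  unfolding perm_gen_mat_def
proof (rule the1_equality[OF ex1_perm_gen_mat])
  show "is_perm_gen_mat n (mat n n (\<lambda>(i, j). real (stirling (j + 1) (n - i))))"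
    unfolding is_perm_gen_mat_iff
    using pochhammer_eq_sum_stirling_descending[of "_ + 1" n] by simp
qed

lemma perm_gen_entry_eq_stirling:
  assumes "1 \<le> i" "i \<le> n" "1 \<le> j" "j \<le> n"
  shows "perm_gen_entry n i j = real (stirling j (n + 1 - i))"
proof -
  have "n - (i - 1) = n + 1 - i" using assms by simp
  then show ?thesis
    using assms by (simp add: perm_gen_entry_def perm_gen_mat_eq_stirling)
qed

theorem lemma2p3:
  fixes n i j :: nat
  assumes "n \<ge> 1" and "1 \<le> i" "i \<le> n" and "1 \<le> j" "j \<le> n"
  shows "(i + j < n + 1 \<longrightarrow> perm_gen_entry n i j = 0) \<and>
    (i + j = n + 1 \<longrightarrow> perm_gen_entry n i j = 1) \<and>
    (i + j > n + 1 \<and> i < n \<longrightarrow>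
       perm_gen_entry n i j
         = (real j - 1) * perm_gen_entry n i (j - 1) + perm_gen_entry n (i + 1) (j - 1)) \<and>
    (i = n \<and> j \<ge> 2 \<longrightarrow>
       perm_gen_entry n n j = (real j - 1) * perm_gen_entry n n (j - 1))"
proof (intro conjI impI)
  assume "i + j < n + 1"
  then show "perm_gen_entry n i j = 0"
    using assms by (simp add: perm_gen_entry_eq_stirling)
next
  assume "i + j = n + 1"
  then have "n + 1 - i = j" by simp
  then show "perm_gen_entry n i j = 1"
    using assms by (simp add: perm_gen_entry_eq_stirling)
next
  assume ij: "i + j > n + 1 \<and> i < n"
  then obtain a where a: "j = Suc a" "1 \<le> a"
    by (cases j) auto
  have "n + 1 - i = Suc (n - i)" using ij by linarith
  then show "perm_gen_entry n i j
      = (real j - 1) * perm_gen_entry n i (j - 1) + perm_gen_entry n (i + 1) (j - 1)"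
    using assms ij a by (simp add: perm_gen_entry_eq_stirling)
next
  assume j: "i = n \<and> j \<ge> 2"
  then obtain b where "j = Suc (Suc b)"
    by (metis add_2_eq_Suc le_Suc_ex)
  then show "perm_gen_entry n n j = (real j - 1) * perm_gen_entry n n (j - 1)"
    using assms by (simp add: perm_gen_entry_eq_stirling algebra_simps)
qed

end
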